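(* Let $1<d_1<d_2<d_3$ be integers with $\gcd(d_1,d_2,d_3)=1$ such that $\{d_1,d_2,d_3\}$ is a minimal generating set of the numerical semigroup $S=S(d_1,d_2,d_3)$, and assume $S$ is non-symmetric. Let $a_{ij}$ ($1\le i,j\le 3$) be the coefficients of the 1st minimal relation, and put $\langle \mathbf a,\mathbf d\rangle=\sum_{i=1}^3 a_{ii}d_i$ and $$J=\sqrt{\langle \mathbf a,\mathbf d\rangle^2-4\sum_{1\le j<i\le 3}a_{ii}a_{jj}d_id_j+4d_1d_2d_3}.$$ Then the numerator $Q(z)$ of the Hilbert series of $S$ is $$Q(z)=1-\sum_{i=1}^3 z^{a_{ii}d_i}+z^{\frac12\left(\langle \mathbf a,\mathbf d\rangle-J\right)}+z^{\frac12\left(\langle \mathbf a,\mathbf d\rangle+J\right)}.$$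
   Context: $S(d_1,d_2,d_3)=\{r_1d_1+r_2d_2+r_3d_3: r_i\in\mathbb Z_{\ge0}\}$. The set $\{d_1,d_2,d_3\}$ is minimal if no $d_i$ is a nonnegative integer combination of the other two. The Frobenius number $F$ is the largest positive integer not in $S$. $S$ is symmetric if for every $s\in S$ one has $F-s\notin S$; otherwise non-symmetric. The 1st minimal relation: for each $i$, $a_{ii}=\min\{v\ge2:\ v d_i=\sum_{j\ne i}v_{ij}d_j \text{ for some } v_{ij}\in\mathbb Z_{\ge0}\}$, and $a_{ij}$ ($j\neq i$) are the coefficients $v_{ij}$ realizing this minimum, so $a_{11}d_1=a_{12}d_2+a_{13}d_3$, $a_{22}d_2=a_{21}d_1+a_{23}d_3$, $a_{33}d_3=a_{31}d_1+a_{32}d_2$ (for non-symmetric $S$ these coefficients are uniquely determined and all $a_{ij}$, $i\ne j$, are positive). The Hilbert series of $S$ is $H(z)=\sum_{s\in S}z^s=Q(z)/\prod_{j=1}^3(1-z^{d_j})$ with $Q$ a polynomial. *)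

theory Defs
  imports Complex_Main "HOL-Computational_Algebra.Polynomial_FPS"
begin

text \<open>The generators and the coefficients of the relations are indexed by 1, 2, 3; values of
  the functions \<open>d\<close> and \<open>a\<close> at other indices are irrelevant.\<close>

definition semigroup3 :: "(nat \<Rightarrow> nat) \<Rightarrow> nat set" where
  "semigroup3 d = {s. \<exists>r :: nat \<Rightarrow> nat. s = (\<Sum>i=1..3. r i * d i)}"

definition minimal_generators :: "(nat \<Rightarrow> nat) \<Rightarrow> bool" where
  "minimal_generators d \<longleftrightarrow>
     (\<forall>i\<in>{1..3}. \<not> (\<exists>r :: nat \<Rightarrow> nat. d i = (\<Sum>j\<in>{1..3} - {i}. r j * d j)))"

text \<open>Meaningful when the set of gaps is finite and nonempty, as it is for coprime
  generators greater than 1.\<close>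

definition frobenius_number :: "nat set \<Rightarrow> nat" where
  "frobenius_number S = Max {n. 0 < n \<and> n \<notin> S}"

text \<open>The quantifier ranges over all integers and the condition is an equivalence.  The
  implication from left to right holds in every numerical semigroup with Frobenius number \<open>F\<close>,
  since otherwise \<open>F = s + (F - s)\<close> would be in \<open>S\<close>; symmetry is the converse.\<close>

definition symmetric_semigroup :: "nat set \<Rightarrow> bool" where
  "symmetric_semigroup S \<longleftrightarrow>
     (\<forall>s :: int. s \<in> int ` S \<longleftrightarrow> int (frobenius_number S) - s \<notin> int ` S)"

definition first_minimal_relation :: "(nat \<Rightarrow> nat) \<Rightarrow> (nat \<Rightarrow> nat \<Rightarrow> nat) \<Rightarrow> bool" where
  "first_minimal_relation d a \<longleftrightarrow>
     (\<forall>i\<in>{1..3}.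
        a i i = (LEAST v. 2 \<le> v \<and> (\<exists>w :: nat \<Rightarrow> nat. v * d i = (\<Sum>j\<in>{1..3} - {i}. w j * d j))) \<and>
        a i i * d i = (\<Sum>j\<in>{1..3} - {i}. a i j * d j))"

definition hilbert_series :: "nat set \<Rightarrow> real fps" where
  "hilbert_series S = Abs_fps (\<lambda>n. if n \<in> S then 1 else 0)"

definition is_hilbert_numerator :: "(nat \<Rightarrow> nat) \<Rightarrow> real poly \<Rightarrow> bool" where
  "is_hilbert_numerator d Q \<longleftrightarrow>
     hilbert_series (semigroup3 d) = fps_of_poly Q / (\<Prod>j=1..3. 1 - fps_X ^ d j)"

definition pairing :: "(nat \<Rightarrow> nat \<Rightarrow> nat) \<Rightarrow> (nat \<Rightarrow> nat) \<Rightarrow> real" where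
  "pairing a d = (\<Sum>i=1..3. real (a i i) * real (d i))"

definition radicand :: "(nat \<Rightarrow> nat \<Rightarrow> nat) \<Rightarrow> (nat \<Rightarrow> nat) \<Rightarrow> real" where
  "radicand a d =
     (pairing a d)\<^sup>2
     - 4 * (\<Sum>i=1..3. \<Sum>j=1..<i. real (a i i) * real (a j j) * real (d i) * real (d j))
     + 4 * real (d 1) * real (d 2) * real (d 3)"

definition J :: "(nat \<Rightarrow> nat \<Rightarrow> nat) \<Rightarrow> (nat \<Rightarrow> nat) \<Rightarrow> real" where
  "J a d = sqrt (radicand a d)"

end

theory Submission
  imports Defs
begin

text \<open>Following Herzog, non-symmetry forces the three degrees \<open>a\<^sub>i\<^sub>i * d\<^sub>i\<close> to be distinct and all
  \<open>a\<^sub>i\<^sub>j\<close> to be positive, whence \<open>a\<^sub>i\<^sub>i = a\<^sub>j\<^sub>i + a\<^sub>k\<^sub>i\<close>. The elements of \<open>S\<close> that leave \<open>S\<close> on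
  subtracting \<open>d\<^sub>1\<close> are then the \<open>p * d\<^sub>2 + q * d\<^sub>3\<close> with \<open>(p, q)\<close> in an L-shape, the rectangle
  \<open>a\<^sub>2\<^sub>2 \<times> a\<^sub>3\<^sub>3\<close> without its corner \<open>a\<^sub>3\<^sub>2 \<times> a\<^sub>2\<^sub>3\<close>. Summing geometric series over it gives \<open>Q\<close> with the
  two further exponents \<open>e = a\<^sub>1\<^sub>1 * d\<^sub>1 + a\<^sub>3\<^sub>2 * d\<^sub>2\<close> and \<open>f = a\<^sub>1\<^sub>1 * d\<^sub>1 + a\<^sub>2\<^sub>3 * d\<^sub>3\<close>. Since the L-shape is
  a system of residues modulo \<open>d\<^sub>1\<close>, its size \<open>a\<^sub>2\<^sub>2 * a\<^sub>3\<^sub>3 - a\<^sub>3\<^sub>2 * a\<^sub>2\<^sub>3\<close> is \<open>d\<^sub>1\<close>; this evaluates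
  \<open>e * f\<close>, and \<open>J\<^sup>2 = (e + f)\<^sup>2 - 4 * e * f\<close>.\<close>

section \<open>The semigroup in three named generators, and a criterion for symmetry\<close>

definition combos :: "nat \<Rightarrow> nat \<Rightarrow> nat \<Rightarrow> nat set" where
  "combos x y z = {n. \<exists>p q r. n = p * x + q * y + r * z}"

lemma combosI: "n = p * x + q * y + r * z \<Longrightarrow> n \<in> combos x y z"
  unfolding combos_def by blast

lemma combos_rotate: "combos y z x = combos x y z"
proof -
  have "combos y z x \<subseteq> combos x y z" for x y z
  proof
    fix n assume "n \<in> combos y z x"
    then obtain p q r where "n = p * y + q * z + r * x" unfolding combos_def by blast
    then show "n \<in> combos x y z" by (intro combosI[of _ r _ p _ q]) simp
  qed
  then show ?thesis by (meson subset_antisym subset_trans)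
qed

lemma combos_swap: "combos y x z = combos x y z"
proof -
  have "combos y x z \<subseteq> combos x y z" for x y z
  proof
    fix n assume "n \<in> combos y x z"
    then obtain p q r where "n = p * y + q * x + r * z" unfolding combos_def by blast
    then show "n \<in> combos x y z" by (intro combosI[of _ q _ p _ r]) simp
  qed
  then show ?thesis by (meson subset_antisym)
qed

lemma indices: "{1..3::nat} = {1, 2, 3}" "{1..<2::nat} = {1}" "{1..<3::nat} = {1, 2}"
  by auto

lemma semigroup3_eq_combos: "semigroup3 d = combos (d 1) (d 2) (d 3)"
proof (intro set_eqI iffI)
  fix n assume "n \<in> semigroup3 d"
  then obtain r where "n = (\<Sum>i=1..3. r i * d i)"
    unfolding semigroup3_def by blast
  then show "n \<in> combos (d 1) (d 2) (d 3)"
    unfolding indices by (intro combosI[of _ "r 1" _ "r 2" _ "r 3"]) simp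
next
  fix n assume "n \<in> combos (d 1) (d 2) (d 3)"
  then obtain p q r where "n = p * d 1 + q * d 2 + r * d 3"
    unfolding combos_def by blast
  then have "n = (\<Sum>i=1..3. (if i = 1 then p else if i = 2 then q else r) * d i)"
    unfolding indices by simp
  then show "n \<in> semigroup3 d"
    unfolding semigroup3_def by (intro CollectI exI)
qed

lemma bezout3:
  fixes x y z :: nat and n :: int
  assumes "Gcd {x, y, z} = 1"
  obtains p q r where "n = p * int x + q * int y + r * int z"
proof -
  obtain u v where uv: "u * int y + v * int z = gcd (int y) (int z)"
    using bezout_int by blast
  obtain s t where st: "s * int x + t * gcd (int y) (int z) = gcd (int x) (gcd (int y) (int z))"
    using bezout_int by blast
  have "gcd (int x) (gcd (int y) (int z)) = 1"
    using assms by (simp add: gcd_int_int_eq)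
  then have "n = n * (s * int x + t * (u * int y + v * int z))"
    using uv st by simp
  then have "n = (n * s) * int x + (n * t * u) * int y + (n * t * v) * int z"
    by (simp add: algebra_simps)
  then show ?thesis by (rule that)
qed

text \<open>\<open>G\<close> need not be known beforehand to be the Frobenius number:
  \<open>0 \<in> S\<close> makes it a gap, every gap \<open>n\<close> has \<open>G - n\<close> in
  \<open>S\<close> and so is at most \<open>G\<close>, and the gap 1 makes \<open>G\<close>
  positive.\<close>

lemma symmetric_semigroupI:
  fixes S :: "nat set" and G :: int
  assumes S: "0 \<in> S" "1 \<notin> S"
    and refl: "\<And>n. n \<in> int ` S \<longleftrightarrow> G - n \<notin> int ` S"
  shows "symmetric_semigroup S"
proof -
  have "1 \<notin> int ` S" using S(2) by force
  then have "G - 1 \<in> int ` S" using refl[of 1] by blast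
  then have "G \<ge> 1" by auto
  then obtain g where g: "G = int g" "0 < g"
    by (metis int_one_le_iff_zero_less nat_0_le order_trans zero_le_one zero_less_nat_eq)
  have "g \<notin> S" using refl[of 0] S(1) g by (auto simp: image_iff)
  moreover have le: "n \<le> g" if "n \<notin> S" for n
  proof -
    have "int n \<notin> int ` S" using that by force
    then have "G - int n \<in> int ` S" using refl[of "int n"] by blast
    then show ?thesis using g by auto
  qed
  moreover have "finite {n. 0 < n \<and> n \<notin> S}"
    by (rule finite_subset[of _ "{..g}"]) (use le in auto)
  ultimately have "frobenius_number S = g"
    unfolding frobenius_number_def using g(2) by (intro Max_eqI) auto
  then show ?thesis unfolding symmetric_semigroup_def using refl unfolding g(1) by metis
qed

section \<open>Minimal relations under permutations of the generators\<close>

text \<open>The generators are \<open>(x, y, z) = (d\<^sub>1, d\<^sub>2, d\<^sub>3)\<close>, the row of the relation matrix belonging to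
  \<open>x\<close> is \<open>a = a\<^sub>1\<^sub>1\<close>, \<open>ay = a\<^sub>1\<^sub>2\<close>, \<open>az = a\<^sub>1\<^sub>3\<close>, and the other rows follow with the off-diagonal entries
  in cyclic order, so that cyclic symmetry is a rotation of the parameters.\<close>

locale minimal_relations =
  fixes x y z a ay az b bz bx c cx cy :: nat
  assumes gt1: "1 < x" "1 < y" "1 < z"
    and gcd1: "Gcd {x, y, z} = 1"
    and diag_pos: "0 < a" "0 < b" "0 < c"
    and rel: "a * x = ay * y + az * z" "b * y = bz * z + bx * x" "c * z = cx * x + cy * y"
    and a_min: "\<And>m v w. 0 < m \<Longrightarrow> m * x = v * y + w * z \<Longrightarrow> a \<le> m"
    and b_min: "\<And>m v w. 0 < m \<Longrightarrow> m * y = v * z + w * x \<Longrightarrow> b \<le> m"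
    and c_min: "\<And>m v w. 0 < m \<Longrightarrow> m * z = v * x + w * y \<Longrightarrow> c \<le> m"
begin

lemma rotate: "minimal_relations y z x b bz bx c cx cy a ay az"
proof
  show "Gcd {y, z, x} = 1" using gcd1 by (simp add: insert_commute)
qed (use gt1 diag_pos rel in \<open>auto intro: a_min b_min c_min\<close>)

text \<open>A transposition reverses the cyclic order, so the off-diagonal entries of every row
  trade places. Together with \<open>rotate\<close> it reaches all six permutations.\<close>

lemma swap: "minimal_relations y x z b bx bz a az ay c cy cx"
proof
  show "Gcd {y, x, z} = 1" using gcd1 by (simp add: insert_commute)
next
  fix m v w assume "0 < m" "m * y = v * x + w * z"
  then show "b \<le> m" using b_min[of m w v] by simp
next
  fix m v w assume "0 < m" "m * x = v * z + w * y"
  then show "a \<le> m" using a_min[of m w v] by simp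
next
  fix m v w assume "0 < m" "m * z = v * y + w * x"
  then show "c \<le> m" using c_min[of m w v] by simp
qed (use gt1 diag_pos rel in auto)

section \<open>Equal degrees force symmetry\<close>

text \<open>If two of the relations have the same degree, every integer has a unique normal form
  \<open>m * x + p * y + q * z\<close> with \<open>p < b\<close> and \<open>q < c\<close>, and the reflection
  \<open>(m, p, q) \<mapsto> (-1 - m, b - 1 - p, c - 1 - q)\<close> exchanges \<open>S\<close> with its complement.\<close>

lemma normal_form_exists:
  assumes eq: "a * x = b * y"
  obtains m q r where "u * int x + v * int y + w * int z = m * int x + q * int y + r * int z"
    "0 \<le> q" "q < int b" "0 \<le> r" "r < int c"
    "0 \<le> u \<Longrightarrow> 0 \<le> v \<Longrightarrow> 0 \<le> w \<Longrightarrow> 0 \<le> m"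
proof -
  \<comment> \<open>The relation of \<open>z\<close> first brings its coefficient below
    \<open>c\<close>; trading \<open>b\<close> copies of \<open>y\<close> for \<open>a\<close>
    copies of \<open>x\<close> then reduces \<open>y\<close> without disturbing
    \<open>z\<close>.\<close>
  define k where "k = w div int c"
  define v' where "v' = v + k * int cy"
  define l where "l = v' div int b"
  define m where "m = u + k * int cx + l * int a"
  have C: "int c * int z = int cx * int x + int cy * int y"
    and B: "int b * int y = int a * int x"
    using rel(3) eq by (metis of_nat_add of_nat_mult)+
  have w: "w = k * int c + w mod int c" and v: "v' = l * int b + v' mod int b"
    unfolding k_def l_def by simp_all
  have "w * int z = k * (int c * int z) + (w mod int c) * int z"
    by (subst w) (simp add: algebra_simps)
  moreover have "v' * int y = l * (int b * int y) + (v' mod int b) * int y"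
    by (subst v) (simp add: algebra_simps)
  ultimately have "u * int x + v * int y + w * int z
      = m * int x + (v' mod int b) * int y + (w mod int c) * int z"
    unfolding B C m_def by (simp add: v'_def algebra_simps)
  moreover have "0 \<le> m" if "0 \<le> u" "0 \<le> v" "0 \<le> w"
  proof -
    have "0 \<le> k" using that by (simp add: k_def div_int_pos_iff)
    moreover from this have "0 \<le> l" using that by (simp add: v'_def l_def div_int_pos_iff)
    ultimately show ?thesis using that by (simp add: m_def)
  qed
  ultimately show ?thesis
    using diag_pos by (intro that[of m "v' mod int b" "w mod int c"]) auto
qed

text \<open>If \<open>r' < r\<close>, reducing the coefficient of \<open>y\<close> modulo
  \<open>b\<close> gives \<open>(r - r') * z = p' * x + s' * y\<close> with
  \<open>0 \<le> s' < b\<close>. For \<open>p' \<ge> 0\<close> this contradicts the minimality of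
  \<open>c\<close>; for \<open>p' < 0\<close>, moving \<open>x\<close> across contradicts that of
  \<open>b\<close>.\<close>

lemma normal_form_le:
  assumes eq: "a * x = b * y"
    and rep: "m * int x + q * int y + r * int z = m' * int x + q' * int y + r' * int z"
    and bounds: "0 \<le> r'" "r < int c"
  shows "r \<le> r'"
proof (rule ccontr)
  assume "\<not> r \<le> r'"
  then have r: "r' < r" by simp
  define l where "l = (q' - q) div int b"
  have B: "int b * int y = int a * int x" using eq by (metis of_nat_mult)
  define s' where "s' = (q' - q) mod int b"
  define p' where "p' = m' - m + l * int a"
  have s': "0 \<le> s'" "s' < int b" using diag_pos by (auto simp: s'_def)
  have "q' - q = l * int b + s'" by (simp add: l_def s'_def)
  then have "(q' - q) * int y = l * (int b * int y) + s' * int y"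
    by (simp add: algebra_simps)
  then have key: "(r - r') * int z = p' * int x + s' * int y"
    using rep unfolding B p'_def by (simp add: algebra_simps)
  show False
  proof (cases "0 \<le> p'")
    case True
    have "int (nat (r - r') * z) = int (nat p' * x + nat s' * y)"
      using key True s' r by simp
    then have "nat (r - r') * z = nat p' * x + nat s' * y" by (simp only: of_nat_eq_iff)
    then have "c \<le> nat (r - r')" using c_min[of "nat (r - r')"] r by simp
    then show False using bounds r by linarith
  next
    case False
    have "s' * int y = (r - r') * int z + (- p') * int x" using key by simp
    moreover have "0 < (r - r') * int z" using r gt1 by simp
    moreover have "0 \<le> (- p') * int x" using False by (simp add: mult_nonpos_nonneg)
    ultimately have "0 < s' * int y" by linarith
    then have pos: "0 < s'" using gt1 by (simp add: zero_less_mult_iff)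
    have "int (nat s' * y) = int (nat (r - r') * z + nat (- p') * x)"
      using key False s' r by simp
    then have "nat s' * y = nat (r - r') * z + nat (- p') * x" by (simp only: of_nat_eq_iff)
    then have "b \<le> nat s'" using b_min[of "nat s'"] pos by simp
    then show False using s' by linarith
  qed
qed

lemma normal_form_unique:
  assumes eq: "a * x = b * y"
    and rep: "m * int x + q * int y + r * int z = m' * int x + q' * int y + r' * int z"
    and bounds: "0 \<le> q" "q < int b" "0 \<le> q'" "q' < int b"
      "0 \<le> r" "r < int c" "0 \<le> r'" "r' < int c"
  shows "m = m'"
proof -
  have le: "n' \<le> n" if e: "n * int x + k * int y = n' * int x + k' * int y"
      and k: "0 \<le> k'" "k < int b" for n n' k k'
  proof (rule ccontr)
    assume "\<not> n' \<le> n"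
    then have n: "n < n'" by simp
    have e': "(k - k') * int y = (n' - n) * int x" using e by (simp add: algebra_simps)
    have "0 < (n' - n) * int x" using n gt1 by simp
    then have kk: "0 < k - k'" using gt1 unfolding e'[symmetric] by (simp add: zero_less_mult_iff)
    have "int (nat (k - k') * y) = int (0 * z + nat (n' - n) * x)" using e' kk n by simp
    then have "nat (k - k') * y = 0 * z + nat (n' - n) * x" by (simp only: of_nat_eq_iff)
    then have "b \<le> nat (k - k')" using b_min[of "nat (k - k')" 0 "nat (n' - n)"] kk by simp
    then show False using k kk by linarith
  qed
  have "r = r'"
    using normal_form_le[OF eq rep] normal_form_le[OF eq rep[symmetric]] bounds by simp
  then have e: "m * int x + q * int y = m' * int x + q' * int y" using rep by simp
  show ?thesis using le[OF e] le[OF e[symmetric]] bounds by simp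
qed

lemma one_notin_combos: "1 \<notin> combos x y z"
proof
  assume "1 \<in> combos x y z"
  then obtain p q r where e: "1 = p * x + q * y + r * z" unfolding combos_def by blast
  have "p = 0 \<or> x \<le> p * x" "q = 0 \<or> y \<le> q * y" "r = 0 \<or> z \<le> r * z" by auto
  then show False using e gt1 by (elim disjE) auto
qed

lemma equal_degrees_imp_symmetric:
  assumes eq: "a * x = b * y"
  shows "symmetric_semigroup (combos x y z)"
proof (rule symmetric_semigroupI)
  show "0 \<in> combos x y z" by (rule combosI[of _ 0 _ 0 _ 0]) simp
  show "1 \<notin> combos x y z" by (rule one_notin_combos)
  \<comment> \<open>The sign of the \<open>x\<close>-coefficient alone decides membership, so
    uniqueness is needed only for \<open>m\<close>.\<close>
  have mem: "n \<in> int ` combos x y z \<longleftrightarrow> 0 \<le> m"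
    if n: "n = m * int x + q * int y + r * int z"
      and bounds: "0 \<le> q" "q < int b" "0 \<le> r" "r < int c" for n m q r
  proof
    assume "n \<in> int ` combos x y z"
    then obtain i j k where "n = int (i * x + j * y + k * z)" unfolding combos_def by blast
    then have n': "n = int i * int x + int j * int y + int k * int z" by simp
    obtain m' q' r' where nf: "n = m' * int x + q' * int y + r' * int z"
        "0 \<le> q'" "q' < int b" "0 \<le> r'" "r' < int c" "0 \<le> m'"
      using normal_form_exists[OF eq, of "int i" "int j" "int k"] unfolding n' by auto
    have "m = m'" using normal_form_unique[OF eq n[symmetric, unfolded nf(1), symmetric]]
        bounds nf by blast
    then show "0 \<le> m" using nf by simp
  next
    assume "0 \<le> m"
    then have "n = int (nat m * x + nat q * y + nat r * z)" using n bounds by simp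
    then show "n \<in> int ` combos x y z" using combosI by blast
  qed
  fix n :: int
  obtain u v w where "n = u * int x + v * int y + w * int z" using bezout3[OF gcd1] by blast
  then obtain m q r where n: "n = m * int x + q * int y + r * int z"
      and bounds: "0 \<le> q" "q < int b" "0 \<le> r" "r < int c"
    using normal_form_exists[OF eq, of u v w] by metis
  \<comment> \<open>\<open>G\<close> has coefficients \<open>(-1, b - 1, c - 1)\<close>: reflection
    in it preserves the bounds on \<open>q\<close> and \<open>r\<close> and reverses the sign
    condition on \<open>m\<close>.\<close>
  define G where "G = (int b - 1) * int y + (int c - 1) * int z - int x"
  have "G - n = (- 1 - m) * int x + (int b - 1 - q) * int y + (int c - 1 - r) * int z"
    unfolding G_def n by (simp add: algebra_simps)
  then have "G - n \<in> int ` combos x y z \<longleftrightarrow> 0 \<le> - 1 - m"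
    by (rule mem) (use bounds in auto)
  moreover have "n \<in> int ` combos x y z \<longleftrightarrow> 0 \<le> m"
    using n bounds by (rule mem)
  moreover have "0 \<le> m \<longleftrightarrow> \<not> 0 \<le> - 1 - m" by linarith
  ultimately show "n \<in> int ` combos x y z \<longleftrightarrow>
      (int b - 1) * int y + (int c - 1) * int z - int x - n \<notin> int ` combos x y z"
    unfolding G_def by blast
qed

section \<open>A vanishing coefficient forces symmetry\<close>

text \<open>The conclusion \<open>bx = 0\<close> is the hypothesis of the rotated statement, so with distinct degrees
  a single zero yields the cycle \<open>a * x > b * y > c * z > a * x\<close>.\<close>

lemma zero_step:
  assumes "az = 0" and ne: "a * x \<noteq> b * y"
  shows "b * y < a * x" "bx = 0"
proof -
  have e: "a * x = ay * y" using rel(1) assms by simp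
  have "0 < a * x" using gt1 diag_pos by simp
  then have "0 < ay" using e by (cases ay) auto
  then have "b \<le> ay" using b_min[of ay 0 a] e by simp
  moreover have "b \<noteq> ay" using ne e by auto
  ultimately have lt: "b < ay" by simp
  then show less: "b * y < a * x" using gt1 e by simp
  show "bx = 0"
  proof (rule ccontr)
    assume "bx \<noteq> 0"
    have "bx * x < a * x" using less rel(2) by linarith
    then have "bx < a" by simp
    then obtain k where k: "a = bx + k" "0 < k" using less_imp_add_positive by blast
    obtain l where l: "ay = b + l" using lt less_imp_add_positive by blast
    \<comment> \<open>Cancelling the relation of \<open>y\<close> from \<open>a * x = ay * y\<close>
      leaves a shorter multiple of \<open>x\<close>.\<close>
    have "k * x = l * y + bz * z"
      using e rel(2) unfolding k(1) l by (simp add: add_mult_distrib)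
    then have "a \<le> k" using a_min k by blast
    then show False using \<open>bx \<noteq> 0\<close> k by simp
  qed
qed

lemma zero_imp_equal_degrees:
  assumes "az = 0"
  shows "a * x = b * y \<or> b * y = c * z \<or> c * z = a * x"
proof (rule ccontr)
  assume ne: "\<not> ?thesis"
  interpret r: minimal_relations y z x b bz bx c cx cy a ay az by (rule rotate)
  interpret rr: minimal_relations z x y c cx cy a ay az b bz bx by (rule r.rotate)
  show False using zero_step r.zero_step rr.zero_step assms ne by simp
qed

lemma zero_imp_symmetric:
  assumes "az = 0"
  shows "symmetric_semigroup (combos x y z)"
proof -
  interpret r: minimal_relations y z x b bz bx c cx cy a ay az by (rule rotate)
  interpret rr: minimal_relations z x y c cx cy a ay az b bz bx by (rule r.rotate)
  show ?thesis
    using zero_imp_equal_degrees[OF assms] equal_degrees_imp_symmetric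
      r.equal_degrees_imp_symmetric rr.equal_degrees_imp_symmetric
    by (metis combos_rotate)
qed

end

section \<open>Positive coefficients and the column sums of the relation matrix\<close>

locale positive_relations = minimal_relations +
  assumes off_pos: "0 < ay" "0 < az" "0 < bz" "0 < bx" "0 < cx" "0 < cy"

text \<open>The original order and the five permuted ones put each off-diagonal coefficient once in
  the place of \<open>az\<close>.\<close>

lemma (in minimal_relations) positive_if_not_symmetric:
  assumes ns: "\<not> symmetric_semigroup (combos x y z)"
  shows "positive_relations x y z a ay az b bz bx c cx cy"
proof
  interpret r: minimal_relations y z x b bz bx c cx cy a ay az by (rule rotate)
  interpret rr: minimal_relations z x y c cx cy a ay az b bz bx by (rule r.rotate)
  interpret s: minimal_relations y x z b bx bz a az ay c cy cx by (rule swap)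
  interpret sr: minimal_relations x z y a az ay c cy cx b bx bz by (rule s.rotate)
  interpret srr: minimal_relations z y x c cy cx b bx bz a az ay by (rule sr.rotate)
  show "0 < az" "0 < bx" "0 < cy" "0 < bz" "0 < ay" "0 < cx"
    using ns zero_imp_symmetric r.zero_imp_symmetric rr.zero_imp_symmetric
      s.zero_imp_symmetric sr.zero_imp_symmetric srr.zero_imp_symmetric
    by (metis combos_rotate combos_swap neq0_conv)+
qed

context positive_relations
begin

lemma rotate_pos: "positive_relations y z x b bz bx c cx cy a ay az"
  by (intro positive_relations.intro rotate positive_relations_axioms.intro off_pos)

lemma swap_pos: "positive_relations y x z b bx bz a az ay c cy cx"
  by (intro positive_relations.intro swap positive_relations_axioms.intro off_pos)

text \<open>Otherwise \<open>c * z\<close> could be replaced inside the relation of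
  \<open>y\<close>; this puts \<open>cy > 0\<close> copies of \<open>y\<close> on the right, and
  cancelling them gives a multiple of \<open>y\<close> smaller than \<open>b\<close> allows.\<close>

lemma off_less: "bz < c"
proof (rule ccontr)
  assume "\<not> bz < c"
  then obtain k where k: "bz = c + k" using le_Suc_ex not_less by blast
  then have e: "b * y = (bx + cx) * x + cy * y + k * z"
    using rel by (simp add: algebra_simps)
  moreover have "0 < (bx + cx) * x" using off_pos gt1 by simp
  ultimately have "cy * y < b * y" by linarith
  then have lt: "cy < b" by simp
  have "(b - cy) * y = k * z + (bx + cx) * x"
    using e by (simp add: diff_mult_distrib)
  then have "b \<le> b - cy" using b_min[of "b - cy"] lt by auto
  then show False using off_pos lt by simp
qed

text \<open>Adding the relations of \<open>y\<close> and \<open>z\<close> and cancelling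
  \<open>cy * y\<close> and \<open>bz * z\<close>, which \<open>off_less\<close> permits, expresses
  \<open>(bx + cx) * x\<close> through \<open>y\<close> and \<open>z\<close>.\<close>

lemma column_le: "a \<le> bx + cx"
proof -
  interpret s: positive_relations y x z b bx bz a az ay c cy cx by (rule swap_pos)
  interpret sr: positive_relations x z y a az ay c cy cx b bx bz by (rule s.rotate_pos)
  obtain k l where k: "c = bz + k" "b = cy + l"
    using off_less sr.off_less by (metis less_imp_add_positive)
  have "b * y + c * z = (bx + cx) * x + cy * y + bz * z"
    using rel by (simp add: algebra_simps)
  then have "(bx + cx) * x = l * y + k * z" unfolding k by (simp add: algebra_simps)
  then show ?thesis using a_min[of "bx + cx"] off_pos by simp
qed

text \<open>Adding all three relations shows that the excesses in \<open>column_le\<close> and its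
  rotations, weighted by the positive generators, sum to zero.\<close>

lemma column_sums: "a = bx + cx" "b = ay + cy" "c = az + bz"
proof -
  interpret r: positive_relations y z x b bz bx c cx cy a ay az by (rule rotate_pos)
  interpret rr: positive_relations z x y c cx cy a ay az b bz bx by (rule r.rotate_pos)
  obtain i j k where ijk: "bx + cx = a + i" "cy + ay = b + j" "az + bz = c + k"
    using column_le r.column_le rr.column_le le_Suc_ex by metis
  have "a * x + b * y + c * z = (bx + cx) * x + (cy + ay) * y + (az + bz) * z"
    using rel by (simp add: algebra_simps)
  then have "i * x + j * y + k * z = 0" unfolding ijk by (simp add: algebra_simps)
  then have "i = 0" "j = 0" "k = 0" using gt1 by auto
  then show "a = bx + cx" "b = ay + cy" "c = az + bz" using ijk by simp_all
qed

section \<open>The L-shape as a system of residues modulo \<open>x\<close>\<close>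

definition L_shape :: "(nat \<times> nat) set" where
  "L_shape = {..<b} \<times> {..<c} - {ay..<b} \<times> {az..<c}"

lemma mem_L_shape:
  "(p, q) \<in> L_shape \<longleftrightarrow> p < b \<and> q < c \<and> (p < ay \<or> q < az)"
  unfolding L_shape_def by auto

lemma finite_L_shape: "finite L_shape"
  unfolding L_shape_def by auto

text \<open>A representation with the largest possible coefficient of \<open>x\<close> is in normal form, since
  each of the three relations trades other generators for copies of \<open>x\<close>.\<close>

lemma L_shape_rep:
  assumes "n \<in> combos x y z"
  obtains m p q where "n = m * x + p * y + q * z" "(p, q) \<in> L_shape"
proof -
  define P where "P m \<longleftrightarrow> (\<exists>p q. n = m * x + p * y + q * z)" for m
  have "\<exists>m. P m" using assms unfolding combos_def P_def by blast
  moreover have bound: "m \<le> n" if "P m" for m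
  proof -
    have "m * 1 \<le> m * x" using gt1 by (intro mult_le_mono) auto
    then show ?thesis using that unfolding P_def by (metis mult.right_neutral trans_le_add1 le_trans)
  qed
  ultimately obtain m where m: "P m" and max: "\<And>m'. P m' \<Longrightarrow> m' \<le> m"
    by (metis GreatestI_ex_nat Greatest_le_nat)
  obtain p q where n: "n = m * x + p * y + q * z" using m unfolding P_def by blast
  have "p < b"
  proof (rule ccontr)
    assume "\<not> p < b"
    then obtain k where "p = b + k" using le_Suc_ex not_less by blast
    then have "n = (m + bx) * x + k * y + (q + bz) * z"
      using n rel(2) by (simp add: algebra_simps)
    then show False using max[of "m + bx"] off_pos unfolding P_def by fastforce
  qed
  moreover have "q < c"
  proof (rule ccontr)
    assume "\<not> q < c"
    then obtain k where "q = c + k" using le_Suc_ex not_less by blast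
    then have "n = (m + cx) * x + (p + cy) * y + k * z"
      using n rel(3) by (simp add: algebra_simps)
    then show False using max[of "m + cx"] off_pos unfolding P_def by fastforce
  qed
  moreover have "p < ay \<or> q < az"
  proof (rule ccontr)
    assume "\<not> (p < ay \<or> q < az)"
    then obtain k l where "p = ay + k" "q = az + l" by (metis le_Suc_ex not_less)
    then have "n = (m + a) * x + k * y + l * z"
      using n rel(1) by (simp add: algebra_simps)
    then show False using max[of "m + a"] diag_pos unfolding P_def by fastforce
  qed
  ultimately show ?thesis using that n mem_L_shape by blast
qed

text \<open>Since \<open>m \<ge> a\<close>, the relation of \<open>x\<close> can be subtracted. As
  \<open>u < ay\<close> or \<open>v < az\<close>, what remains is a positive multiple of
  \<open>z\<close> below \<open>c\<close> or of \<open>y\<close> below \<open>b\<close>.\<close>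

lemma L_shape_no_relation:
  assumes "(u, v) \<in> L_shape" and e: "m * x = u * y + v * z" and m: "0 < m"
  shows False
proof -
  have uv: "u < b" "v < c" "u < ay \<or> v < az" using assms mem_L_shape by auto
  obtain k where "m = a + k" using a_min[OF m e] le_Suc_ex by blast
  then have e': "k * x + ay * y + az * z = u * y + v * z"
    using e rel(1) by (simp add: algebra_simps)
  from uv(3) show False
  proof
    assume "u < ay"
    then obtain l where l: "ay = u + l" "0 < l" using less_imp_add_positive by blast
    have f: "k * x + l * y + az * z = v * z" using e' l by (simp add: algebra_simps)
    have "0 < l * y" using l gt1 by simp
    with f have "az * z < v * z" by linarith
    then have "az < v" by simp
    moreover have "(v - az) * z = k * x + l * y" using f by (simp add: diff_mult_distrib)
    ultimately have "c \<le> v - az" using c_min[of "v - az"] by auto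
    then show False using uv off_pos by simp
  next
    assume "v < az"
    then obtain l where l: "az = v + l" "0 < l" using less_imp_add_positive by blast
    have f: "k * x + l * z + ay * y = u * y" using e' l by (simp add: algebra_simps)
    have "0 < l * z" using l gt1 by simp
    with f have "ay * y < u * y" by linarith
    then have "ay < u" by simp
    moreover have "(u - ay) * y = l * z + k * x" using f by (simp add: diff_mult_distrib)
    ultimately have "b \<le> u - ay" using b_min[of "u - ay"] by auto
    then show False using uv off_pos by simp
  qed
qed

text \<open>If \<open>p' < p\<close> and \<open>q' \<le> q\<close>, the difference of the pairs lies
  in the L-shape again, which is closed downwards. If \<open>q < q'\<close>, the equation gives a
  multiple of \<open>y\<close> below \<open>b\<close> or of \<open>z\<close> below
  \<open>c\<close>.\<close>

lemma L_shape_le: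
  assumes "(p, q) \<in> L_shape" "(p', q') \<in> L_shape"
    and e: "m * x + p * y + q * z = m' * x + p' * y + q' * z"
  shows "p \<le> p'"
proof (rule ccontr)
  assume "\<not> p \<le> p'"
  then obtain u where u: "p = p' + u" "0 < u" using less_imp_add_positive not_le by blast
  have b: "p < b" "q < c" "p < ay \<or> q < az" "p' < b" "q' < c" using assms mem_L_shape by auto
  have uy: "0 < u * y" using u gt1 by simp
  show False
  proof (cases "q' \<le> q")
    case True
    then obtain v where v: "q = q' + v" using le_Suc_ex by blast
    have e': "m * x + u * y + v * z = m' * x" using e u v by (simp add: algebra_simps)
    with uy have "m * x < m' * x" by linarith
    then have "m < m'" by simp
    moreover have "(m' - m) * x = u * y + v * z" using e' by (simp add: diff_mult_distrib)
    moreover have "(u, v) \<in> L_shape" using b u v by (auto simp: mem_L_shape)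
    ultimately show False using L_shape_no_relation[of u v "m' - m"] by simp
  next
    case False
    then obtain v where v: "q' = q + v" "0 < v" using less_imp_add_positive not_le by blast
    have e': "m * x + u * y = m' * x + v * z" using e u v by (simp add: algebra_simps)
    show False
    proof (cases "m \<le> m'")
      case True
      then obtain k where "m' = m + k" using le_Suc_ex by blast
      then have "u * y = v * z + k * x" using e' by (simp add: algebra_simps)
      then show False using b_min[OF u(2)] b u by fastforce
    next
      case False
      then obtain k where "m = m' + k" by (metis le_Suc_ex nat_le_linear)
      then have "v * z = k * x + u * y" using e' by (simp add: algebra_simps)
      then show False using c_min[OF v(2)] b v by fastforce
    qed
  qed
qed

lemma L_shape_unique:
  assumes L: "(p, q) \<in> L_shape" "(p', q') \<in> L_shape"
    and e: "m * x + p * y + q * z = m' * x + p' * y + q' * z"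
  shows "p = p'" "q = q'" "m = m'"
proof -
  show p: "p = p'" using L_shape_le[OF L e] L_shape_le[OF L(2,1) e[symmetric]] by simp
  have False if "(p, u) \<in> L_shape" "k * x + u * z = k' * x + u' * z" "u' < u" for k u k' u'
  proof -
    obtain v where v: "u = u' + v" "0 < v" using \<open>u' < u\<close> less_imp_add_positive by blast
    have e': "k * x + v * z = k' * x" using that v by (simp add: algebra_simps)
    have "0 < v * z" using v gt1 by simp
    with e' have "k * x < k' * x" by linarith
    then have "k < k'" by simp
    moreover have "(k' - k) * x = 0 * y + v * z" using e' by (simp add: diff_mult_distrib)
    moreover have "(0, v) \<in> L_shape"
      using that(1) v off_pos diag_pos by (auto simp: mem_L_shape)
    ultimately show False using L_shape_no_relation[of 0 v "k' - k"] by simp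
  qed
  moreover have "m * x + q * z = m' * x + q' * z" using e p by simp
  ultimately show q: "q = q'" using L p by (metis linorder_neqE_nat)
  show "m = m'" using e p q gt1 by simp
qed

lemma card_L_shape: "card L_shape = x"
proof -
  define h where "h = (\<lambda>(p, q). (p * y + q * z) mod x)"
  have "bij_betw h L_shape {..<x}"
  proof (intro bij_betwI')
    fix s t assume st: "s \<in> L_shape" "t \<in> L_shape"
    obtain p q p' q' where pq: "s = (p, q)" "t = (p', q')" by (metis surj_pair)
    show "h s = h t \<longleftrightarrow> s = t"
    proof
      assume "h s = h t"
      then have *: "(p * y + q * z) mod x = (p' * y + q' * z) mod x" by (simp add: h_def pq)
      define k k' where "k = (p * y + q * z) div x" and "k' = (p' * y + q' * z) div x"
      have "p * y + q * z = k * x + (p * y + q * z) mod x"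
        and "p' * y + q' * z = k' * x + (p' * y + q' * z) mod x"
        by (simp_all add: k_def k'_def)
      \<comment> \<open>Each side receives the quotient of the other, which equates the two sums
        without subtraction.\<close>
      with * have "k' * x + p * y + q * z = k * x + p' * y + q' * z" by linarith
      then show "s = t" using L_shape_unique st pq by blast
    qed simp
  next
    fix s assume "s \<in> L_shape"
    then show "h s \<in> {..<x}" using gt1 by (auto simp: h_def split: prod.splits)
  next
    fix n assume n: "n \<in> {..<x}"
    obtain u v w where uvw: "int n = u * int x + v * int y + w * int z"
      using bezout3[OF gcd1] by blast
    \<comment> \<open>Reducing the Bezout coefficients modulo \<open>x\<close> makes them
      nonnegative and keeps the residue, so \<open>L_shape_rep\<close> applies.\<close>
    define v' w' where "v' = nat (v mod int x)" and "w' = nat (w mod int x)"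
    have "int (v' * y + w' * z) = (v mod int x) * int y + (w mod int x) * int z"
      using gt1 by (simp add: v'_def w'_def)
    also have "\<dots> mod int x = (v * int y + w * int z) mod int x"
      by (intro mod_add_cong mod_mult_cong) simp_all
    also have "\<dots> = (u * int x + v * int y + w * int z) mod int x"
      by (simp add: add.assoc)
    also have "\<dots> = int (n mod x)" by (simp add: uvw[symmetric] zmod_int)
    finally have vw: "(v' * y + w' * z) mod x = n mod x" by (metis of_nat_eq_iff zmod_int)
    have "v' * y + w' * z \<in> combos x y z" by (rule combosI[of _ 0 _ v' _ w']) simp
    then obtain m p q where *: "v' * y + w' * z = m * x + p * y + q * z" "(p, q) \<in> L_shape"
      by (rule L_shape_rep)
    have "h (p, q) = n" using vw n unfolding *(1) h_def by (simp add: add.assoc)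
    then show "\<exists>s\<in>L_shape. n = h s" using *(2) by blast
  qed
  then show ?thesis using bij_betw_same_card by fastforce
qed

text \<open>By the column sums the removed corner has sides \<open>cy\<close> and \<open>bz\<close>;
  counting the L-shape makes \<open>x\<close> a 2 by 2 minor of the relation matrix.\<close>

lemma determinant: "b * c = x + cy * bz"
proof -
  have "card L_shape = b * c - (b - ay) * (c - az)"
    unfolding L_shape_def by (subst card_Diff_subset) auto
  moreover have "b - ay = cy" "c - az = bz" using column_sums(2,3) by simp_all
  ultimately have "x = b * c - cy * bz" by (simp add: card_L_shape)
  moreover have "cy * bz \<le> b * c" using column_sums by (intro mult_le_mono) auto
  ultimately show ?thesis by simp
qed

section \<open>The Hilbert series and its numerator\<close>

text \<open>The factor \<open>1 - fps_X ^ x\<close> leaves the generating function of the Apery set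
  of \<open>S\<close> with respect to \<open>x\<close>, whose elements are those with
  \<open>m = 0\<close> in \<open>L_shape_rep\<close>.\<close>

lemma hilbert_series_L_shape:
  "hilbert_series (combos x y z) * (1 - fps_X ^ x)
     = (\<Sum>(p, q)\<in>L_shape. fps_X ^ (p * y) * fps_X ^ (q * z))"
proof (rule fps_ext)
  fix n
  let ?S = "combos x y z"
  define h where "h = (\<lambda>(p, q). p * y + q * z)"
  have inj: "inj_on h L_shape"
  proof (rule inj_onI)
    fix s t assume st: "s \<in> L_shape" "t \<in> L_shape" "h s = h t"
    obtain p q p' q' where pq: "s = (p, q)" "t = (p', q')" by (metis surj_pair)
    then have "0 * x + p * y + q * z = 0 * x + p' * y + q' * z" using st by (simp add: h_def)
    then show "s = t" using L_shape_unique st pq by blast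
  qed
  have add: "k + x \<in> ?S" if k: "k \<in> ?S" for k
  proof -
    obtain p q r where "k = p * x + q * y + r * z" using k unfolding combos_def by blast
    then show ?thesis by (intro combosI[of _ "p + 1" _ q _ r]) simp
  qed
  have apery: "n \<in> h ` L_shape \<longleftrightarrow> n \<in> ?S \<and> \<not> (x \<le> n \<and> n - x \<in> ?S)"
  proof
    assume "n \<in> h ` L_shape"
    then obtain p q where pq: "(p, q) \<in> L_shape" "n = p * y + q * z" by (auto simp: h_def)
    have "\<not> (x \<le> n \<and> n - x \<in> ?S)"
    proof
      assume *: "x \<le> n \<and> n - x \<in> ?S"
      then obtain m p' q' where mpq: "n - x = m * x + p' * y + q' * z" "(p', q') \<in> L_shape"
        using L_shape_rep by blast
      have "n = (n - x) + x" using * by simp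
      then have "(m + 1) * x + p' * y + q' * z = 0 * x + p * y + q * z"
        using mpq(1) pq by (simp add: algebra_simps)
      then show False using L_shape_unique(3)[OF mpq(2) pq(1)] by fastforce
    qed
    then show "n \<in> ?S \<and> \<not> (x \<le> n \<and> n - x \<in> ?S)"
      using pq(2) combosI[of n 0 x p y q z] by simp
  next
    assume *: "n \<in> ?S \<and> \<not> (x \<le> n \<and> n - x \<in> ?S)"
    then obtain m p q where mpq: "n = m * x + p * y + q * z" "(p, q) \<in> L_shape"
      using L_shape_rep by blast
    have "m = 0"
    proof (cases m)
      case (Suc k)
      then have "x \<le> n" "n - x = k * x + p * y + q * z" using mpq by auto
      then show ?thesis using * combosI by blast
    qed
    then show "n \<in> h ` L_shape" using mpq by (auto simp: h_def intro!: image_eqI[of _ _ "(p, q)"])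
  qed
  have "fps_nth (hilbert_series ?S * (1 - fps_X ^ x)) n
      = (if n \<in> ?S then 1 else 0) - (if x \<le> n \<and> n - x \<in> ?S then 1 else (0 :: real))"
    by (auto simp: right_diff_distrib hilbert_series_def fps_X_power_mult_right_nth)
  \<comment> \<open>Closure of \<open>S\<close> under adding \<open>x\<close> rules out the value
    -1.\<close>
  also have "\<dots> = (if n \<in> h ` L_shape then 1 else 0)"
    using apery add[of "n - x"] by auto
  also have "\<dots> = (\<Sum>k\<in>h ` L_shape. if n = k then 1 else 0)"
    using finite_L_shape by simp
  also have "\<dots> = (\<Sum>s\<in>L_shape. if n = h s then 1 else 0)"
    by (subst sum.reindex[OF inj]) simp
  also have "\<dots> = fps_nth (\<Sum>(p, q)\<in>L_shape. fps_X ^ (p * y) * fps_X ^ (q * z)) n"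
    unfolding fps_sum_nth
    by (intro sum.cong) (auto simp: h_def fps_X_power_nth simp flip: power_add)
  finally show "fps_nth (hilbert_series ?S * (1 - fps_X ^ x)) n
      = fps_nth (\<Sum>(p, q)\<in>L_shape. fps_X ^ (p * y) * fps_X ^ (q * z)) n" .
qed

lemma hilbert_series_times:
  "hilbert_series (combos x y z) * ((1 - fps_X ^ x) * (1 - fps_X ^ y) * (1 - fps_X ^ z))
    = 1 - fps_X ^ (a * x) - fps_X ^ (b * y) - fps_X ^ (c * z)
      + fps_X ^ (a * x + cy * y) + fps_X ^ (a * x + bz * z)"
proof -
  define X :: "real fps" where "X = fps_X"
  have geo: "(\<Sum>p\<in>{i..<i + k}. X ^ (p * w)) * (1 - X ^ w) = X ^ (i * w) * (1 - X ^ (k * w))"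
    for i k w
  proof -
    have "(\<Sum>p\<in>{i..<i + k}. X ^ (p * w)) = (\<Sum>p<k. X ^ ((p + i) * w))"
      using sum.shift_bounds_nat_ivl[of "\<lambda>p. X ^ (p * w)" 0 i k]
      by (simp add: atLeast0LessThan add.commute)
    also have "\<dots> = X ^ (i * w) * (\<Sum>p<k. (X ^ w) ^ p)"
      by (simp add: sum_distrib_left power_add power_mult[symmetric] algebra_simps)
    finally have "(\<Sum>p\<in>{i..<i + k}. X ^ (p * w)) * (1 - X ^ w)
        = X ^ (i * w) * ((1 - X ^ w) * (\<Sum>p<k. (X ^ w) ^ p))"
      by (simp only: ac_simps)
    then show ?thesis
      unfolding one_diff_power_eq[of "X ^ w" k, symmetric]
      by (simp only: power_mult[symmetric] mult.commute[of w k])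
  qed
  \<comment> \<open>\<open>R\<close> is the generating function of the \<open>k\<close> by
    \<open>l\<close> rectangle with lowest corner \<open>(i, j)\<close>.\<close>
  define R where "R i k j l = (\<Sum>(p, q)\<in>{i..<i + k} \<times> {j..<j + l}. X ^ (p * y) * X ^ (q * z))"
    for i k j l
  have R: "R i k j l * ((1 - X ^ y) * (1 - X ^ z))
      = (X ^ (i * y) * (1 - X ^ (k * y))) * (X ^ (j * z) * (1 - X ^ (l * z)))" for i k j l
    unfolding geo[symmetric] R_def sum.cartesian_product[symmetric] sum_product[symmetric]
    by (simp only: ac_simps)
  have shape: "L_shape = {0..<0 + b} \<times> {0..<0 + c} - {ay..<ay + cy} \<times> {az..<az + bz}"
    unfolding L_shape_def column_sums(2,3)[symmetric] by (simp add: atLeast0LessThan)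
  have "{ay..<ay + cy} \<times> {az..<az + bz} \<subseteq> {0..<0 + b} \<times> {0..<0 + c}"
    unfolding column_sums(2,3) by auto
  then have L: "(\<Sum>(p, q)\<in>L_shape. X ^ (p * y) * X ^ (q * z)) = R 0 b 0 c - R ay cy az bz"
    unfolding R_def shape by (intro sum_diff) auto
  have "hilbert_series (combos x y z) * ((1 - X ^ x) * (1 - X ^ y) * (1 - X ^ z))
      = (R 0 b 0 c - R ay cy az bz) * ((1 - X ^ y) * (1 - X ^ z))"
    using hilbert_series_L_shape unfolding X_def[symmetric] L by (simp flip: mult.assoc)
  also have "\<dots> = (1 - X ^ (b * y)) * (1 - X ^ (c * z))
      - X ^ (ay * y + az * z) * ((1 - X ^ (cy * y)) * (1 - X ^ (bz * z)))"
    unfolding left_diff_distrib[of "R 0 b 0 c"] R power_add by (simp only: ac_simps) simp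
  also have "\<dots> = 1 - X ^ (b * y) - X ^ (c * z) + X ^ (b * y + c * z)
      - X ^ (ay * y + az * z) + X ^ (ay * y + az * z + cy * y) + X ^ (ay * y + az * z + bz * z)
      - X ^ (ay * y + az * z + cy * y + bz * z)"
    unfolding power_add by (simp add: algebra_simps)
  \<comment> \<open>Both rectangles end at the same corner \<open>(b, c)\<close>, so their top terms
    cancel.\<close>
  also have "ay * y + az * z + cy * y + bz * z = b * y + c * z"
    unfolding column_sums(2,3) by (simp add: algebra_simps)
  finally show ?thesis unfolding rel(1)[symmetric] X_def by simp
qed

text \<open>Sum and product of the two further exponents, stated without subtraction. In the
  product, \<open>determinant\<close> merges \<open>x * y * z\<close> with
  \<open>cy * bz * y * z\<close> into \<open>(b * y) * (c * z)\<close>.\<close>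

lemma exponents:
  "(a * x + cy * y) + (a * x + bz * z) = a * x + b * y + c * z"
  "(a * x + cy * y) * (a * x + bz * z) + x * y * z
    = (a * x) * (b * y) + (a * x) * (c * z) + (b * y) * (c * z)"
proof -
  have s: "a * x + cy * y + bz * z = b * y + c * z"
    using rel(1) unfolding column_sums(2,3) by (simp add: algebra_simps)
  then show "(a * x + cy * y) + (a * x + bz * z) = a * x + b * y + c * z" by simp
  have "(a * x + cy * y) * (a * x + bz * z) + x * y * z
      = (a * x) * (a * x + cy * y + bz * z) + (x + cy * bz) * y * z"
    by (simp add: algebra_simps)
  also have "\<dots> = (a * x) * (b * y) + (a * x) * (c * z) + (b * y) * (c * z)"
    unfolding s determinant[symmetric] by (simp add: algebra_simps)
  finally show "(a * x + cy * y) * (a * x + bz * z) + x * y * z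
    = (a * x) * (b * y) + (a * x) * (c * z) + (b * y) * (c * z)" .
qed

end

section \<open>From the indexed definitions to the named parameters\<close>

text \<open>Minimality of the generators excludes the multiple 1, so the bound
  \<open>2 \<le> v\<close> may be weakened to \<open>0 < m\<close>.\<close>

lemma least_multiple:
  fixes x y z :: nat
  assumes "1 < y" and c: "c = (LEAST v. 2 \<le> v \<and> (\<exists>p q. v * x = p * y + q * z))"
    and nontriv: "\<And>p q. x \<noteq> p * y + q * z"
  shows "0 < c" "\<And>m p q. 0 < m \<Longrightarrow> m * x = p * y + q * z \<Longrightarrow> c \<le> m"
proof -
  \<comment> \<open>The multiple \<open>y * x = x * y\<close> shows that the minimum exists.\<close>
  have "2 \<le> y \<and> (\<exists>p q. y * x = p * y + q * z)"
  proof
    show "2 \<le> y" using \<open>1 < y\<close> by simp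
    have "y * x = x * y + 0 * z" by simp
    then show "\<exists>p q. y * x = p * y + q * z" by blast
  qed
  from LeastI[of "\<lambda>v. 2 \<le> v \<and> (\<exists>p q. v * x = p * y + q * z)", OF this]
  show "0 < c" unfolding c by linarith
  fix m p q assume m: "0 < m" "m * x = p * y + q * z"
  then have "m \<noteq> 1" using nontriv[of p q] by auto
  then show "c \<le> m" unfolding c using m by (intro Least_le) auto
qed

lemma ex_sum_pair:
  fixes d :: "nat \<Rightarrow> nat"
  assumes "j \<noteq> k"
  shows "(\<exists>w. n = (\<Sum>i\<in>{j, k}. w i * d i)) \<longleftrightarrow> (\<exists>p q. n = p * d j + q * d k)"
proof
  assume "\<exists>p q. n = p * d j + q * d k"
  then obtain p q where "n = p * d j + q * d k" by blast
  then show "\<exists>w. n = (\<Sum>i\<in>{j, k}. w i * d i)"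
    using assms by (intro exI[of _ "\<lambda>i. if i = j then p else q"]) simp
qed (use assms in auto)

lemma first_minimal_relation_imp_minimal_relations:
  assumes "1 < d 1" "1 < d 2" "1 < d 3" "Gcd {d 1, d 2, d 3} = 1"
    and gen: "minimal_generators d" and rel: "first_minimal_relation d a"
  shows "minimal_relations (d 1) (d 2) (d 3) (a 1 1) (a 1 2) (a 1 3)
    (a 2 2) (a 2 3) (a 2 1) (a 3 3) (a 3 1) (a 3 2)"
proof -
  have I: "{1..3} - {1} = {2, 3::nat}" "{1..3} - {2} = {3, 1::nat}" "{1..3} - {3} = {1, 2::nat}"
    by auto
  have E: "(\<exists>w. n = (\<Sum>j\<in>{1..3} - {1}. w j * d j)) \<longleftrightarrow> (\<exists>p q. n = p * d 2 + q * d 3)"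
    "(\<exists>w. n = (\<Sum>j\<in>{1..3} - {2}. w j * d j)) \<longleftrightarrow> (\<exists>p q. n = p * d 3 + q * d 1)"
    "(\<exists>w. n = (\<Sum>j\<in>{1..3} - {3}. w j * d j)) \<longleftrightarrow> (\<exists>p q. n = p * d 1 + q * d 2)" for n
    unfolding I by (rule ex_sum_pair, simp)+
  have g: "\<not> (\<exists>w. d i = (\<Sum>j\<in>{1..3} - {i}. w j * d j))" if "i \<in> {1..3}" for i
    using gen that unfolding minimal_generators_def by blast
  have n: "d 1 \<noteq> p * d 2 + q * d 3" "d 2 \<noteq> p * d 3 + q * d 1" "d 3 \<noteq> p * d 1 + q * d 2" for p q
    using g[of 1] g[of 2] g[of 3] unfolding E by auto
  have f: "a i i = (LEAST v. 2 \<le> v \<and> (\<exists>w. v * d i = (\<Sum>j\<in>{1..3} - {i}. w j * d j)))"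
    "a i i * d i = (\<Sum>j\<in>{1..3} - {i}. a i j * d j)" if "i \<in> {1..3}" for i
    using rel that unfolding first_minimal_relation_def by blast+
  have l: "a 1 1 = (LEAST v. 2 \<le> v \<and> (\<exists>p q. v * d 1 = p * d 2 + q * d 3))"
     "a 2 2 = (LEAST v. 2 \<le> v \<and> (\<exists>p q. v * d 2 = p * d 3 + q * d 1))"
     "a 3 3 = (LEAST v. 2 \<le> v \<and> (\<exists>p q. v * d 3 = p * d 1 + q * d 2))"
    using f(1)[of 1] f(1)[of 2] f(1)[of 3] unfolding E by simp_all
  have r: "a 1 1 * d 1 = a 1 2 * d 2 + a 1 3 * d 3" "a 2 2 * d 2 = a 2 3 * d 3 + a 2 1 * d 1"
     "a 3 3 * d 3 = a 3 1 * d 1 + a 3 2 * d 2"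
    using f(2)[of 1] f(2)[of 2] f(2)[of 3] unfolding I by simp_all
  show ?thesis
    using assms(1-4) r least_multiple[OF _ l(1) n(1)] least_multiple[OF _ l(2) n(2)]
      least_multiple[OF _ l(3) n(3)]
    by unfold_locales blast+
qed

text \<open>The denominator has constant term 1 and is a unit among power series, so the numerator
  is unique.\<close>

lemma is_hilbert_numerator_iff:
  assumes "0 < d 1" "0 < d 2" "0 < d 3"
    and H: "hilbert_series (semigroup3 d) * (\<Prod>j=1..3. 1 - fps_X ^ d j) = fps_of_poly P"
  shows "is_hilbert_numerator d Q \<longleftrightarrow> Q = P"
proof -
  define D :: "real fps" where "D = (\<Prod>j=1..3. 1 - fps_X ^ d j)"
  have "fps_nth D 0 = 1" using assms unfolding D_def indices by (simp add: fps_X_power_nth)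
  then have D: "fps_nth D 0 \<noteq> 0" by simp
  have "is_hilbert_numerator d Q \<longleftrightarrow> hilbert_series (semigroup3 d) = fps_of_poly Q * inverse D"
    unfolding is_hilbert_numerator_def D_def[symmetric] using D by (simp add: fps_divide_unit)
  also have "\<dots> \<longleftrightarrow> hilbert_series (semigroup3 d) * D = fps_of_poly Q"
  proof
    assume "hilbert_series (semigroup3 d) = fps_of_poly Q * inverse D"
    then show "hilbert_series (semigroup3 d) * D = fps_of_poly Q"
      using inverse_mult_eq_1[OF D] by (simp add: mult.assoc)
  next
    assume "hilbert_series (semigroup3 d) * D = fps_of_poly Q"
    from this[symmetric] show "hilbert_series (semigroup3 d) = fps_of_poly Q * inverse D"
      using inverse_mult_eq_1'[OF D] by (simp add: mult.assoc)
  qed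
  also have "\<dots> \<longleftrightarrow> Q = P" unfolding H[folded D_def] by auto
  finally show ?thesis .
qed

theorem theorem7:
  fixes d :: "nat \<Rightarrow> nat" and a :: "nat \<Rightarrow> nat \<Rightarrow> nat"
  assumes "1 < d 1" and "d 1 < d 2" and "d 2 < d 3"
    and "Gcd {d 1, d 2, d 3} = 1"
    and "minimal_generators d"
    and "\<not> symmetric_semigroup (semigroup3 d)"
    and "first_minimal_relation d a"
  shows "0 \<le> radicand a d \<and>
    (\<exists>e f :: nat.
       real e = (pairing a d - J a d) / 2 \<and>
       real f = (pairing a d + J a d) / 2 \<and>
       (\<forall>Q :: real poly. is_hilbert_numerator d Q \<longleftrightarrow>
          Q = 1 - (\<Sum>i=1..3. monom 1 (a i i * d i)) + monom 1 e + monom 1 f))"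
proof -
  interpret minimal_relations "d 1" "d 2" "d 3" "a 1 1" "a 1 2" "a 1 3"
    "a 2 2" "a 2 3" "a 2 1" "a 3 3" "a 3 1" "a 3 2"
    using assms by (intro first_minimal_relation_imp_minimal_relations) auto
  interpret positive_relations "d 1" "d 2" "d 3" "a 1 1" "a 1 2" "a 1 3"
    "a 2 2" "a 2 3" "a 2 1" "a 3 3" "a 3 1" "a 3 2"
    using assms by (intro positive_if_not_symmetric) (simp add: semigroup3_eq_combos)
  define e0 f0 where "e0 = a 1 1 * d 1 + a 3 2 * d 2" and "f0 = a 1 1 * d 1 + a 2 3 * d 3"
  \<comment> \<open>Which of \<open>e0\<close> and \<open>f0\<close> is larger depends on the
    generators; ordering them makes \<open>f - e\<close> the nonnegative root
    \<open>J\<close>.\<close>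
  define e f where "e = min e0 f0" and "f = max e0 f0"
  have ef: "e \<le> f" "e + f = e0 + f0" "e * f = e0 * f0"
    "monom 1 e + monom 1 f = monom 1 e0 + monom (1 :: real) f0"
    by (auto simp: e_def f_def min_def max_def)
  define A B C where "A = real (a 1 1 * d 1)" and "B = real (a 2 2 * d 2)"
    and "C = real (a 3 3 * d 3)"
  have "real (e + f) = A + B + C" "real (e * f + d 1 * d 2 * d 3) = A * B + A * C + B * C"
    unfolding ef e0_def f0_def exponents A_def B_def C_def by simp_all
  then have sum: "real e + real f = A + B + C"
    and prod: "real e * real f = A * B + A * C + B * C - real (d 1) * real (d 2) * real (d 3)"
    by simp_all
  have pairing: "pairing a d = real e + real f"
    unfolding sum unfolding pairing_def indices by (simp add: A_def B_def C_def)
  have "(\<Sum>i=1..3. \<Sum>j=1..<i. real (a i i) * real (a j j) * real (d i) * real (d j))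
      = A * B + A * C + B * C"
    by (simp add: indices indices[unfolded One_nat_def] A_def B_def C_def)
  then have "radicand a d = (real e + real f)\<^sup>2 - 4 * (real e * real f)"
    unfolding radicand_def pairing prod by simp
  then have rad: "radicand a d = (real f - real e)\<^sup>2"
    by (simp add: power2_eq_square algebra_simps)
  then have J: "J a d = real f - real e" using ef by (simp add: J_def)
  have "hilbert_series (semigroup3 d) * (\<Prod>j=1..3. 1 - fps_X ^ d j)
      = 1 - (\<Sum>i=1..3. fps_X ^ (a i i * d i)) + fps_X ^ e0 + fps_X ^ f0"
    using hilbert_series_times unfolding indices
    by (simp add: semigroup3_eq_combos e0_def f0_def algebra_simps)
  also have "\<dots> = fps_of_poly (1 - (\<Sum>i=1..3. monom 1 (a i i * d i)) + (monom 1 e0 + monom 1 f0))"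
    by (simp add: fps_of_poly_add fps_of_poly_diff fps_of_poly_sum fps_of_poly_monom)
  finally have num: "is_hilbert_numerator d Q \<longleftrightarrow>
      Q = 1 - (\<Sum>i=1..3. monom 1 (a i i * d i)) + monom 1 e + monom 1 f" for Q
    using assms is_hilbert_numerator_iff unfolding ef(4)[symmetric] add.assoc by simp
  show ?thesis
  proof (intro conjI exI allI)
    show "0 \<le> radicand a d" unfolding rad by simp
    show "real e = (pairing a d - J a d) / 2" "real f = (pairing a d + J a d) / 2"
      unfolding pairing J by simp_all
  qed (rule num)
qed

end
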